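(* Let $(A,\oplus)$ be a ccm-magma and $e\in A$ an idempotent element of $A$ (i.e. $e\oplus e=e$). There is a (necessarily unique) internal monoid structure $(A,*_e,e)$ on $A$ with unit $e$ if and only if the equation \[\theta\oplus e=x\oplus y\] has a solution $\theta=\theta(x,y)\in A$ for every $x,y\in A$. In that case $x*_e y$ is given by $\theta(x,y)$.
   Context: A ccm-magma (commutative cancellative medial magma) is a set $A$ with a binary operation $\oplus$ such that for all $a,b,c,d\in A$: (M1) $a\oplus b=b\oplus a$; (M2) $a\oplus c=b\oplus c$ implies $a=b$; (M3) $(a\oplus b)\oplus(c\oplus d)=(a\oplus c)\oplus(b\oplus d)$. An internal monoid structure $(A,*_e,e)$ on $(A,\oplus)$ (in the category of ccm-magmas) is a monoid structure on the set $A$ with operation $*_e$ and unit $e$ that is compatible with $\oplus$, i.e. $(x*_e y)\oplus(z*_e w)=(x\oplus z)*_e(y\oplus w)$ for all $x,y,z,w\in A$, with $e$ idempotent for $\oplus$. *)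

theory Defs
  imports Main
begin

locale ccm_magma =
  fixes oplus :: "'a \<Rightarrow> 'a \<Rightarrow> 'a"  (infixl \<open>\<oplus>\<close> 65)
  assumes oplus_commute: "a \<oplus> b = b \<oplus> a"
    and oplus_right_cancel: "a \<oplus> c = b \<oplus> c \<Longrightarrow> a = b"
    and oplus_medial: "(a \<oplus> b) \<oplus> (c \<oplus> d) = (a \<oplus> c) \<oplus> (b \<oplus> d)"

text \<open>
  A monoid object in the category of ccm-magmas: the last two axioms say that the
  multiplication \<open>A \<times> A \<rightarrow> A\<close> and the unit \<open>1 \<rightarrow> A\<close> are magma homomorphisms.
\<close>

locale internal_monoid = ccm_magma oplus + monoid mult e
  for oplus :: "'a \<Rightarrow> 'a \<Rightarrow> 'a"  (infixl \<open>\<oplus>\<close> 65)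
    and mult :: "'a \<Rightarrow> 'a \<Rightarrow> 'a"  (infixl \<open>\<star>\<close> 70)
    and e :: 'a +
  assumes mult_oplus: "(x \<star> y) \<oplus> (z \<star> w) = (x \<oplus> z) \<star> (y \<oplus> w)"
    and unit_idem: "e \<oplus> e = e"

end

theory Submission
  imports Defs
begin

text \<open>
  The bridge between the two sides is the identity \<open>(x \<star> y) \<oplus> e = x \<oplus> y\<close>.
  Every internal monoid with unit \<open>e\<close> satisfies it, because the interchange law and
  commutativity of \<open>\<oplus>\<close> turn both
  \<open>(x \<star> y) \<oplus> (e \<star> e)\<close> and \<open>(x \<star> e) \<oplus> (e \<star> y)\<close> into \<open>(x \<oplus> e) \<star> (y \<oplus> e)\<close>. As \<open>\<oplus>\<close> is
  cancellative, the identity determines \<open>x \<star> y\<close>; this gives the uniqueness of the monoid, its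
  description by \<open>\<theta>\<close>, and the solvability of the equation.

  Conversely, any operation \<open>\<star>\<close> that satisfies the identity is an internal monoid. Each monoid law
  can be checked after \<open>e\<close> has been added to both sides, possibly several times. Since
  \<open>e = e \<oplus> e\<close>, the medial law distributes these copies of \<open>e\<close> over the operands, where the
  identity replaces every \<open>\<star>\<close> by \<open>\<oplus>\<close>; what remains is an instance of the medial law.
\<close>

lemma (in internal_monoid) mult_oplus_unit: "(x \<star> y) \<oplus> e = x \<oplus> y"
proof -
  have "(x \<star> y) \<oplus> (e \<star> e) = (x \<oplus> e) \<star> (e \<oplus> y)"
    by (simp only: mult_oplus oplus_commute[of y e])
  also have "\<dots> = (x \<star> e) \<oplus> (e \<star> y)"
    by (simp only: mult_oplus)
  finally show ?thesis by simp
qed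

lemma (in internal_monoid) oplus_unit_eq_iff: "\<theta> \<oplus> e = x \<oplus> y \<longleftrightarrow> x \<star> y = \<theta>"
  using mult_oplus_unit oplus_right_cancel by metis

lemma (in ccm_magma) internal_monoidI:
  assumes idem: "e \<oplus> e = e"
    and m: "\<And>x y. m x y \<oplus> e = x \<oplus> y"
  shows "internal_monoid (\<oplus>) m e"
proof (unfold_locales)
  \<comment> \<open>The idempotent \<open>e\<close> acts by an endomorphism of the magma.\<close>
  have distrib: "(a \<oplus> b) \<oplus> e = (a \<oplus> e) \<oplus> (b \<oplus> e)" for a b
    using oplus_medial[of a b e e] by (simp only: idem)
  show "m (m x y) z = m x (m y z)" for x y z
  proof -
    have "(m (m x y) z \<oplus> e) \<oplus> e = (x \<oplus> y) \<oplus> (z \<oplus> e)"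
      by (simp only: m distrib[of "m x y" z])
    also have "\<dots> = (x \<oplus> y) \<oplus> (e \<oplus> z)"
      by (simp only: oplus_commute[of z e])
    also have "\<dots> = (x \<oplus> e) \<oplus> (y \<oplus> z)"
      by (rule oplus_medial)
    also have "\<dots> = (m x (m y z) \<oplus> e) \<oplus> e"
      by (simp only: m distrib[of x "m y z"])
    finally show ?thesis
      by (blast dest: oplus_right_cancel)
  qed
  show "m e x = x" for x
    by (rule oplus_right_cancel[of _ e]) (simp only: m oplus_commute[of e x])
  show "m x e = x" for x
    by (rule oplus_right_cancel[of _ e]) (simp only: m)
  show "m x y \<oplus> m z w = m (x \<oplus> z) (y \<oplus> w)" for x y z w
  proof (rule oplus_right_cancel[of _ e])
    have "(m x y \<oplus> m z w) \<oplus> e = (x \<oplus> y) \<oplus> (z \<oplus> w)"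
      by (simp only: distrib m)
    also have "\<dots> = m (x \<oplus> z) (y \<oplus> w) \<oplus> e"
      by (simp only: m oplus_medial[of x y z w])
    finally show "(m x y \<oplus> m z w) \<oplus> e = m (x \<oplus> z) (y \<oplus> w) \<oplus> e" .
  qed
  show "e \<oplus> e = e" by (rule idem)
qed

theorem corollary4p3:
  fixes oplus :: "'a \<Rightarrow> 'a \<Rightarrow> 'a"  (infixl \<open>\<oplus>\<close> 65)
    and e :: 'a
  assumes "ccm_magma (\<oplus>)"
    and "e \<oplus> e = e"
  shows "((\<exists>m. internal_monoid (\<oplus>) m e) \<longleftrightarrow> (\<forall>x y. \<exists>\<theta>. \<theta> \<oplus> e = x \<oplus> y))
       \<and> (\<exists>\<^sub>\<le>\<^sub>1 m. internal_monoid (\<oplus>) m e)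
       \<and> (\<forall>m. internal_monoid (\<oplus>) m e \<longrightarrow>
            (\<forall>x y \<theta>. \<theta> \<oplus> e = x \<oplus> y \<longleftrightarrow> m x y = \<theta>))"
proof -
  have char: "\<theta> \<oplus> e = x \<oplus> y \<longleftrightarrow> m x y = \<theta>" if "internal_monoid (\<oplus>) m e" for m x y \<theta>
    by (rule internal_monoid.oplus_unit_eq_iff[OF that])
  have solvable: "\<exists>\<theta>. \<theta> \<oplus> e = x \<oplus> y" if "\<exists>m. internal_monoid (\<oplus>) m e" for x y
    using that char by blast
  have monoid: "\<exists>m. internal_monoid (\<oplus>) m e" if "\<forall>x y. \<exists>\<theta>. \<theta> \<oplus> e = x \<oplus> y"
  proof -
    from that obtain m where "\<And>x y. m x y \<oplus> e = x \<oplus> y" by metis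
    then show ?thesis
      using ccm_magma.internal_monoidI[OF assms] by blast
  qed
  have unique: "\<exists>\<^sub>\<le>\<^sub>1 m. internal_monoid (\<oplus>) m e"
  proof (rule Uniq_I)
    fix m m'
    assume "internal_monoid (\<oplus>) m e" "internal_monoid (\<oplus>) m' e"
    then have "m x y = m' x y" for x y
      using char by blast
    then show "m = m'" by blast
  qed
  show ?thesis
    using char solvable monoid unique by blast
qed

end
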